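(* In the setting described in the context, suppose that the linear operators $Y$ and $Y'$ act on the subspace $I_2\subset V^{\otimes 2}$ as $(q+1)$ times the identity operator. Then $\ell_{xy}(x)=\ell_{xx}(y)$ and $\ell'_{xy}(x)=\ell'_{xx}(y)$ for all $x,y\in V$.
   Context: Let $V$ be a $3$-dimensional vector space over a field $k$ and $\zeta\in GL(V)$. Write $xy$ for $x\otimes y$ in $T(V)$. Put $x\barwedge y=\zeta(x)y-\zeta(y)x$ and $x\barwedge y\barwedge z=\zeta^2(x)\zeta(y)z+\zeta^2(y)\zeta(z)x+\zeta^2(z)\zeta(x)y-\zeta^2(x)\zeta(z)y-\zeta^2(y)\zeta(x)z-\zeta^2(z)\zeta(y)x$. Let $I$ be the ideal of $T(V)$ generated by all $x\barwedge y$, $A=T(V)/I$, $I_2=I\cap V^{\otimes2}$, $\Upsilon^{(3)}=(I_2\otimes V)\cap(V\otimes I_2)=\mathrm{span}\{x\barwedge y\barwedge z\}$. Via the isomorphisms $\bigwedge^2V\cong I_2$, $x\wedge y\mapsto x\barwedge y$ and $\bigwedge^3V\cong \Upsilon^{(3)}$, $x\wedge y\wedge z\mapsto x\barwedge y\barwedge z$, one has a bilinear product $x\barwedge w\in\Upsilon^{(3)}$ for $x\in V,w\in I_2$ with $x\barwedge(y\barwedge z)=x\barwedge y\barwedge z$. Let $R$ be a Hecke symmetry on $V$ with parameter $q\ne 0$ (braid equation and $(R-q\,\mathrm{Id})(R+\mathrm{Id})=0$) with $\mathrm{Im}(R-q\,\mathrm{Id})=I_2$ (i.e. $\mathbb{S}(V,R)=A$).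 Put $R'=(\zeta^{-1}\otimes\zeta^{-1})R(\zeta\otimes\zeta)$, $Y=q\,\mathrm{Id}-R$, $Y'=q\,\mathrm{Id}-R'$. Fix a nonzero alternating trilinear form $\omega$ on $V$, let $\tilde\omega:\Upsilon^{(3)}\to k$ be linear with $\tilde\omega(x\barwedge y\barwedge z)=\omega(x,y,z)$, and define $\ell_{xy},\ell'_{xy}\in V^*$ by $\ell_{xy}(z)=\tilde\omega(x\barwedge Y(\zeta(y)z))$, $\ell'_{xy}(z)=\tilde\omega(x\barwedge Y'(\zeta(y)z))$. *)

theory Defs
  imports "HOL-Analysis.Analysis"
begin

text \<open>V = k^3 (any 3-dimensional space over k is isomorphic to it).
  V\<otimes>V is modelled as k^(3\<times>3), V\<otimes>V\<otimes>V as k^(3\<times>3\<times>3);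
  linear maps on V and V\<otimes>V are matrices.\<close>

type_synonym 'k V = "'k ^ 3"
type_synonym 'k V2 = "'k ^ (3 \<times> 3)"
type_synonym 'k V3 = "'k ^ (3 \<times> 3 \<times> 3)"

definition tens :: "'k::field V \<Rightarrow> 'k V \<Rightarrow> 'k V2" where
  "tens x y = (\<chi> p. x $ fst p * y $ snd p)"

definition tens3 :: "'k::field V \<Rightarrow> 'k V \<Rightarrow> 'k V \<Rightarrow> 'k V3" where
  "tens3 x y z = (\<chi> p. x $ fst p * y $ fst (snd p) * z $ snd (snd p))"

text \<open>x barwedge y = zeta(x) y - zeta(y) x\<close>
definition bw2 :: "'k::field ^3^3 \<Rightarrow> 'k V \<Rightarrow> 'k V \<Rightarrow> 'k V2" where
  "bw2 Z x y = tens (Z *v x) y - tens (Z *v y) x"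

text \<open>x barwedge y barwedge z\<close>
definition bw3 :: "'k::field ^3^3 \<Rightarrow> 'k V \<Rightarrow> 'k V \<Rightarrow> 'k V \<Rightarrow> 'k V3" where
  "bw3 Z x y z =
     tens3 ((Z ** Z) *v x) (Z *v y) z + tens3 ((Z ** Z) *v y) (Z *v z) x
   + tens3 ((Z ** Z) *v z) (Z *v x) y - tens3 ((Z ** Z) *v x) (Z *v z) y
   - tens3 ((Z ** Z) *v y) (Z *v x) z - tens3 ((Z ** Z) *v z) (Z *v y) x"

text \<open>I_2 = I \<inter> V\<otimes>V, which is the span of the (homogeneous, degree 2) generators.\<close>
definition I2 :: "'k::field ^3^3 \<Rightarrow> 'k V2 set" where
  "I2 Z = vec.span {bw2 Z x y | x y. True}"

text \<open>Upsilon^(3) = span of all x barwedge y barwedge z\<close>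
definition Ups3 :: "'k::field ^3^3 \<Rightarrow> 'k V3 set" where
  "Ups3 Z = vec.span {bw3 Z x y z | x y z. True}"

text \<open>Kronecker product A \<otimes> B of operators on V, acting on V\<otimes>V\<close>
definition kron :: "'k::field ^3^3 \<Rightarrow> 'k ^3^3 \<Rightarrow> 'k ^(3\<times>3)^(3\<times>3)" where
  "kron A B = (\<chi> p q. A $ fst p $ fst q * B $ snd p $ snd q)"

text \<open>R \<otimes> Id and Id \<otimes> R acting on V\<otimes>V\<otimes>V\<close>
definition R12 :: "'k::field ^(3\<times>3)^(3\<times>3) \<Rightarrow> 'k V3 \<Rightarrow> 'k V3" where
  "R12 R t = (\<chi> p. \<Sum>a\<in>UNIV. \<Sum>b\<in>UNIV.
       R $ (fst p, fst (snd p)) $ (a, b) * t $ (a, b, snd (snd p)))"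

definition R23 :: "'k::field ^(3\<times>3)^(3\<times>3) \<Rightarrow> 'k V3 \<Rightarrow> 'k V3" where
  "R23 R t = (\<chi> p. \<Sum>a\<in>UNIV. \<Sum>b\<in>UNIV.
       R $ (fst (snd p), snd (snd p)) $ (a, b) * t $ (fst p, a, b))"

text \<open>Hecke symmetry with parameter q\<close>
definition hecke :: "'k::field ^(3\<times>3)^(3\<times>3) \<Rightarrow> 'k \<Rightarrow> bool" where
  "hecke R q \<longleftrightarrow>
     (\<forall>t. R12 R (R23 R (R12 R t)) = R23 R (R12 R (R23 R t))) \<and>
     (R - mat q) ** (R + mat 1) = 0"

definition trilinear :: "('k::field V \<Rightarrow> 'k V \<Rightarrow> 'k V \<Rightarrow> 'k) \<Rightarrow> bool" where
  "trilinear w \<longleftrightarrow>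
     (\<forall>y z. Vector_Spaces.linear (*s) (*) (\<lambda>x. w x y z)) \<and>
     (\<forall>x z. Vector_Spaces.linear (*s) (*) (\<lambda>y. w x y z)) \<and>
     (\<forall>x y. Vector_Spaces.linear (*s) (*) (\<lambda>z. w x y z))"

definition alternating3 :: "('k::field V \<Rightarrow> 'k V \<Rightarrow> 'k V \<Rightarrow> 'k) \<Rightarrow> bool" where
  "alternating3 w \<longleftrightarrow>
     (\<forall>x z. w x x z = 0) \<and> (\<forall>x y. w x y y = 0) \<and> (\<forall>x y. w x y x = 0)"

end

theory Submission
  imports Defs
begin

text \<open>Since \<open>\<zeta>(y)x - \<zeta>(x)y = y \<barwedge> x\<close>, the difference \<open>\<ell>\<^sub>x\<^sub>y(x) - \<ell>\<^sub>x\<^sub>x(y)\<close>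
  is \<open>\<omega>t(x \<barwedge> Y(y \<barwedge> x))\<close>. As \<open>y \<barwedge> x \<in> I\<^sub>2\<close>, on which \<open>Y\<close> is a scalar \<open>c\<close>,
  this equals \<open>c \<omega>(x, y, x) = 0\<close>. The same computation applies verbatim to \<open>Y'\<close>.\<close>

lemma bw2_in_I2: "bw2 Z x y \<in> I2 Z"
  unfolding I2_def by (rule vec.span_base) blast

lemma tens_swap_diff_eq_bw2: "tens (Z *v y) x - tens (Z *v x) y = bw2 Z y x"
  by (simp add: bw2_def)

lemma ell_swap_eq_if_scalar_on_I2:
  fixes Z :: "'k::field ^3^3" and M :: "'k ^(3\<times>3)^(3\<times>3)"
    and \<omega> :: "'k V \<Rightarrow> 'k V \<Rightarrow> 'k V \<Rightarrow> 'k"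
    and \<omega>t :: "'k V3 \<Rightarrow> 'k"
    and P :: "'k V \<Rightarrow> 'k V2 \<Rightarrow> 'k V3"
  assumes P_lin: "Vector_Spaces.linear (*s) (*s) (P x)"
    and P_bw: "\<And>y z. P x (bw2 Z y z) = bw3 Z x y z"
    and \<omega>_alt: "alternating3 \<omega>"
    and \<omega>t_lin: "Vector_Spaces.linear (*s) (*) \<omega>t"
    and \<omega>t_bw: "\<And>y z. \<omega>t (bw3 Z x y z) = \<omega> x y z"
    and M_I2: "\<And>w. w \<in> I2 Z \<Longrightarrow> M *v w = c *s w"
  shows "\<omega>t (P x (M *v tens (Z *v y) x)) = \<omega>t (P x (M *v tens (Z *v x) y))"
proof -
  interpret P: module_hom "(*s)" "(*s)" "P x"
    using P_lin by (rule module_hom_linearI)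
  interpret \<omega>t: module_hom "(*s)" "(*)" \<omega>t
    using \<omega>t_lin by (rule module_hom_linearI)
  have "\<omega>t (P x (M *v tens (Z *v y) x)) - \<omega>t (P x (M *v tens (Z *v x) y))
      = \<omega>t (P x (M *v bw2 Z y x))"
    by (simp flip: tens_swap_diff_eq_bw2 add: matrix_vector_mult_diff_distrib P.diff \<omega>t.diff)
  also have "\<dots> = c * \<omega> x y x"
    by (simp add: M_I2 bw2_in_I2 P.scale \<omega>t.scale P_bw \<omega>t_bw)
  also have "\<dots> = 0"
    using \<omega>_alt unfolding alternating3_def by simp
  finally show ?thesis
    by simp
qed

theorem lemma2p2:
  fixes Z :: "'k::field ^3^3"
    and R :: "'k ^(3\<times>3)^(3\<times>3)"
    and q :: 'k
    and \<omega> :: "'k V \<Rightarrow> 'k V \<Rightarrow> 'k V \<Rightarrow> 'k"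
    and \<omega>t :: "'k V3 \<Rightarrow> 'k"
    and P :: "'k V \<Rightarrow> 'k V2 \<Rightarrow> 'k V3"
  assumes Z_inv: "invertible Z"
    and hecke: "hecke R q" and q_nz: "q \<noteq> 0"
    and imR: "range (\<lambda>v. (R - mat q) *v v) = I2 Z"
    and P_lin1: "\<And>w. Vector_Spaces.linear (*s) (*s) (\<lambda>x. P x w)"
    and P_lin2: "\<And>x. Vector_Spaces.linear (*s) (*s) (P x)"
    and P_bw: "\<And>x y z. P x (bw2 Z y z) = bw3 Z x y z"
    and \<omega>_tri: "trilinear \<omega>" and \<omega>_alt: "alternating3 \<omega>" and \<omega>_nz: "\<omega> \<noteq> (\<lambda>x y z. 0)"
    and \<omega>t_lin: "Vector_Spaces.linear (*s) (*) \<omega>t"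
    and \<omega>t_bw: "\<And>x y z. \<omega>t (bw3 Z x y z) = \<omega> x y z"
    and Y_I2: "\<And>w. w \<in> I2 Z \<Longrightarrow> (mat q - R) *v w = (q + 1) *s w"
    and Y'_I2: "\<And>w. w \<in> I2 Z \<Longrightarrow>
          (mat q - kron (matrix_inv Z) (matrix_inv Z) ** R ** kron Z Z) *v w = (q + 1) *s w"
  shows "\<forall>x y.
     \<omega>t (P x ((mat q - R) *v tens (Z *v y) x)) = \<omega>t (P x ((mat q - R) *v tens (Z *v x) y)) \<and>
     \<omega>t (P x ((mat q - kron (matrix_inv Z) (matrix_inv Z) ** R ** kron Z Z) *v tens (Z *v y) x))
       = \<omega>t (P x ((mat q - kron (matrix_inv Z) (matrix_inv Z) ** R ** kron Z Z) *v tens (Z *v x) y))"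
proof (intro allI conjI)
  fix x y
  show "\<omega>t (P x ((mat q - R) *v tens (Z *v y) x)) = \<omega>t (P x ((mat q - R) *v tens (Z *v x) y))"
    by (rule ell_swap_eq_if_scalar_on_I2[OF P_lin2 P_bw \<omega>_alt \<omega>t_lin \<omega>t_bw Y_I2])
  show "\<omega>t (P x ((mat q - kron (matrix_inv Z) (matrix_inv Z) ** R ** kron Z Z) *v tens (Z *v y) x))
      = \<omega>t (P x ((mat q - kron (matrix_inv Z) (matrix_inv Z) ** R ** kron Z Z) *v tens (Z *v x) y))"
    by (rule ell_swap_eq_if_scalar_on_I2[OF P_lin2 P_bw \<omega>_alt \<omega>t_lin \<omega>t_bw Y'_I2])
qed

end
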